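(* Let $b$ be a graph over $(X,m)$, let $p\in[1,\infty)$ and let $d$ be a pseudo metric on $X$ such that all distance balls $B^{(d)}_r(o)$ ($o\in X$, $r\ge0$) are finite sets and such that $$\sum_{y\in X}b(x,y)\,d(x,y)^{p}\leq m(x)\qquad\text{for all }x\in X.$$ Then $$\lambda^{(0)}_{p}\leq\frac{\mu^{p}}{2p^{p}},$$ where $\mu$ is the exponential volume growth of $X$ with respect to $d$.
   Context: Setting: $X$ is a nonempty countable (finite or infinite) set, $C(X)$ is the space of real-valued functions on $X$ and $C_c(X)$ the subspace of finitely supported functions. A graph $b$ over $(X,m)$ consists of a symmetric function $b:X\times X\to[0,\infty)$ with $b(x,x)=0$ and $\sum_{y\in X}b(x,y)<\infty$ for all $x\in X$, and a function $m:X\to(0,\infty)$, extended to a measure on subsets by $m(W)=\sum_{x\in W}m(x)$. $\|f\|_{m,p}=\bigl(\sum_{x\in X}|f(x)|^p m(x)\bigr)^{1/p}$. Energy: $\mathcal{E}_p(f)=\frac12\sum_{x,y\in X}b(x,y)|f(x)-f(y)|^p\in[0,\infty]$ for $f\in C(X)$, and $$\lambda^{(0)}_p=\inf_{0\neq\varphi\in C_c(X)}\frac{\mathcal{E}_p(\varphi)}{\|\varphi\|_{m,p}^p}.$$ A pseudo metric is a symmetric function $d:X\times X\to[0,\infty)$ with $d(x,x)=0$ satisfying the triangle inequality. $B^{(d)}_r(o)=\{x\in X: d(o,x)\le r\}$ is the distance ball with center $o$ and radius $r$. The exponential volume growth is $$\mu=\liminf_{r\to\infty}\ \inf_{o\in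 X}\ \frac1r\log\frac{m(B^{(d)}_r(o))}{m(B^{(d)}_1(o))}\in[0,\infty]$$ (if $\mu=\infty$ the right-hand side of the inequality is read as $+\infty$). *)

theory Defs
  imports "HOL-Analysis.Analysis"
begin

definition graph_over :: "('a::countable \<Rightarrow> 'a \<Rightarrow> real) \<Rightarrow> ('a \<Rightarrow> real) \<Rightarrow> bool" where
  "graph_over b m \<longleftrightarrow>
     (\<forall>x y. 0 \<le> b x y) \<and> (\<forall>x y. b x y = b y x) \<and> (\<forall>x. b x x = 0) \<and>
     (\<forall>x. b x summable_on UNIV) \<and> (\<forall>x. 0 < m x)"

definition pseudo_metric :: "('a \<Rightarrow> 'a \<Rightarrow> real) \<Rightarrow> bool" where
  "pseudo_metric d \<longleftrightarrow>
     (\<forall>x y. 0 \<le> d x y) \<and> (\<forall>x y. d x y = d y x) \<and> (\<forall>x. d x x = 0) \<and>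
     (\<forall>x y z. d x z \<le> d x y + d y z)"

definition dist_ball :: "('a \<Rightarrow> 'a \<Rightarrow> real) \<Rightarrow> 'a \<Rightarrow> real \<Rightarrow> 'a set" where
  "dist_ball d z r = {x. d z x \<le> r}"

definition vol :: "('a \<Rightarrow> real) \<Rightarrow> 'a set \<Rightarrow> ennreal" where
  "vol m W = (\<Sum>\<^sub>\<infinity>x\<in>W. ennreal (m x))"

definition finitely_supported :: "('a \<Rightarrow> real) set" where
  "finitely_supported = {f. finite {x. f x \<noteq> 0}}"

definition energy :: "real \<Rightarrow> ('a \<Rightarrow> 'a \<Rightarrow> real) \<Rightarrow> ('a \<Rightarrow> real) \<Rightarrow> ennreal" where
  "energy p b f = (\<Sum>\<^sub>\<infinity>(x, y)\<in>UNIV. ennreal (b x y * \<bar>f x - f y\<bar> powr p)) / 2"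

text \<open>The norm is only meaningful when the sum converges (otherwise the real-valued
  sum is 0); below it is applied to finitely supported functions only.\<close>

definition lp_norm :: "real \<Rightarrow> ('a \<Rightarrow> real) \<Rightarrow> ('a \<Rightarrow> real) \<Rightarrow> real" where
  "lp_norm p m f = (\<Sum>\<^sub>\<infinity>x. \<bar>f x\<bar> powr p * m x) powr (1 / p)"

definition lambda0 :: "real \<Rightarrow> ('a \<Rightarrow> 'a \<Rightarrow> real) \<Rightarrow> ('a \<Rightarrow> real) \<Rightarrow> ennreal" where
  "lambda0 p b m =
     (INF \<phi>\<in>finitely_supported - {\<lambda>_. 0}. energy p b \<phi> / ennreal (lp_norm p m \<phi> powr p))"

text \<open>Volumes are converted to reals under the logarithm, so the growth rate is only
  meaningful when all distance balls have finite volume, in particular when they are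
  finite sets.\<close>

definition volume_growth :: "('a \<Rightarrow> real) \<Rightarrow> ('a \<Rightarrow> 'a \<Rightarrow> real) \<Rightarrow> ereal" where
  "volume_growth m d =
     Liminf at_top (\<lambda>r::real. INF z.
       ereal (1 / r * ln (enn2real (vol m (dist_ball d z r)) / enn2real (vol m (dist_ball d z 1)))))"

lemma enn2real_vol_finite:
  assumes "finite W" "\<And>x. 0 < m x"
  shows "enn2real (vol m W) = sum m W"
  using assms by (simp add: vol_def sum_ennreal less_imp_le sum_nonneg)

text \<open>For finite balls the growth rate indeed lies in the interval from 0 to infinity.\<close>

lemma volume_growth_nonneg:
  assumes m: "\<And>x. 0 < m x" and d: "pseudo_metric d"
    and fin: "\<And>z r. finite (dist_ball d z r)"
  shows "0 \<le> volume_growth m d"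
  unfolding volume_growth_def
proof (rule Liminf_bounded, rule eventually_mono[OF eventually_ge_at_top[of 1]], rule INF_greatest)
  fix r :: real and z
  assume r: "1 \<le> r"
  have "z \<in> dist_ball d z 1"
    using d by (simp add: dist_ball_def pseudo_metric_def)
  then have pos: "0 < sum m (dist_ball d z 1)"
    using fin m by (intro sum_pos) auto
  have "sum m (dist_ball d z 1) \<le> sum m (dist_ball d z r)"
    using r fin m by (intro sum_mono2) (auto simp: dist_ball_def less_imp_le)
  then have "1 \<le> sum m (dist_ball d z r) / sum m (dist_ball d z 1)"
    using pos by simp
  then show "0 \<le> ereal (1 / r * ln (enn2real (vol m (dist_ball d z r)) / enn2real (vol m (dist_ball d z 1))))"
    using r by (simp add: enn2real_vol_finite[OF fin m])
qed

end

theory Submission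
  imports Defs
begin

text \<open>
  The test functions are truncated exponentials \<open>f = (h - c)\<^sub>+\<close> with \<open>h = exp (- a d(z, \<cdot>))\<close> and
  \<open>c = exp (- a R)\<close>. The logarithmic mean is at most the arithmetic mean, hence at most the
  \<open>p\<close>-power mean, so \<open>\<bar>f x - f y\<bar>\<^sup>p \<le> a\<^sup>p d(x,y)\<^sup>p (h(x)\<^sup>p + h(y)\<^sup>p) / 2\<close>; this factor
  \<open>1/2\<close> is the one in the theorem. Summation gives
  \<open>\<E>\<^sub>p(f) \<le> a\<^sup>p/2 \<cdot> (\<Sum>x\<in>B\<^sub>R. (h(x)\<^sup>p + c\<^sup>p) m(x))\<close>. If \<open>a p > \<mu>\<close>, then for suitable \<open>z\<close> and
  arbitrarily large \<open>R\<close> the cut-off error \<open>c\<^sup>p m(B\<^sub>R)\<close> is negligible against \<open>m(B\<^sub>1)\<close>, and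
  therefore against the norm of \<open>f\<close>. Finally \<open>a\<close> decreases to \<open>\<mu> / p\<close>.
\<close>

section \<open>Elementary inequalities for exponentials and powers\<close>

text \<open>The trapezoid rule overestimates the integral of the convex function \<open>exp\<close>
  over \<open>[0, u]\<close>. Formally, the difference of the two sides vanishes at 0, and its
  derivative \<open>1 + (x - 1) * exp x\<close> is nonnegative because
  \<open>1 - x \<le> exp (- x)\<close>.\<close>

lemma exp_minus_one_le_trapezoid:
  fixes u :: real
  assumes "0 \<le> u"
  shows "2 * (exp u - 1) \<le> u * (exp u + 1)"
proof -
  let ?k = "\<lambda>u::real. u * (exp u + 1) - 2 * (exp u - 1)"
  have "?k 0 \<le> ?k u"
  proof (rule DERIV_nonneg_imp_nondecreasing[OF assms])
    fix x :: real
    have D: "(?k has_real_derivative (1 + (x - 1) * exp x)) (at x)"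
      by (auto intro!: derivative_eq_intros simp: algebra_simps)
    have "(1 - x) * exp x \<le> exp (- x) * exp x"
      using exp_ge_add_one_self[of "- x"] by (intro mult_right_mono) auto
    then have "0 \<le> 1 + (x - 1) * exp x"
      by (simp add: algebra_simps flip: exp_add)
    with D show "\<exists>y. (?k has_real_derivative y) (at x) \<and> 0 \<le> y"
      by blast
  qed
  then show ?thesis by simp
qed

text \<open>Scaling the trapezoid inequality for \<open>u = t - s\<close> by
  \<open>exp (- t)\<close> settles \<open>s \<le> t\<close>; the other case follows by
  symmetry.\<close>

lemma abs_exp_diff_le_trapezoid:
  fixes s t :: real
  shows "\<bar>exp (- s) - exp (- t)\<bar> \<le> \<bar>s - t\<bar> * ((exp (- s) + exp (- t)) / 2)"
proof -
  have *: "exp (- s) - exp (- t) \<le> (t - s) * ((exp (- s) + exp (- t)) / 2)"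
    if "s \<le> t" for s t :: real
  proof -
    have "exp (- t) * (2 * (exp (t - s) - 1)) \<le> exp (- t) * ((t - s) * (exp (t - s) + 1))"
      using exp_minus_one_le_trapezoid[of "t - s"] that by (intro mult_left_mono) auto
    moreover have "exp (- t) * exp (t - s) = exp (- s)"
      by (simp flip: exp_add)
    ultimately show ?thesis
      by (simp add: algebra_simps)
  qed
  show ?thesis
    using *[of s t] *[of t s] by (cases "s \<le> t") (auto simp: algebra_simps abs_if)
qed

lemma powr_midpoint_le:
  fixes x y p :: real
  assumes "1 \<le> p" "0 < x" "0 < y"
  shows "((x + y) / 2) powr p \<le> (x powr p + y powr p) / 2"
  using convex_onD[OF powr_convex[OF assms(1)], of "1 / 2" x y] assms
  by (simp add: field_simps)

text \<open>Convexity of the power, applied to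
  \<open>x + y = (1 - t) * (x / (1 - t)) + t * (y / t)\<close>. The factor of
  \<open>x powr p\<close> tends to 1 as \<open>t\<close> tends to 0, so the leading constant
  survives in the limit; the price is a large factor on \<open>y powr p\<close>.\<close>

lemma powr_add_le_weighted:
  fixes x y p t :: real
  assumes p: "1 \<le> p" and x: "0 \<le> x" and y: "0 < y" and t: "0 < t" "t < 1"
  shows "(x + y) powr p \<le> (1 - t) powr (1 - p) * x powr p + t powr (1 - p) * y powr p"
proof (cases "x = 0")
  case True
  have "1 \<le> t powr (1 - p)"
    using t p powr_mono'[of "1 - p" 0 t] by simp
  then show ?thesis
    using True mult_right_mono[of 1 "t powr (1 - p)" "y powr p"] by simp
next
  case False
  have *: "s * (w / s) powr p = s powr (1 - p) * w powr p" if "0 < s" "0 < w" for s w :: real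
    using that by (simp add: powr_divide powr_diff)
  have "((1 - t) * (x / (1 - t)) + t * (y / t)) powr p
      \<le> (1 - t) * (x / (1 - t)) powr p + t * (y / t) powr p"
    using convex_onD[OF powr_convex[OF p], of t "x / (1 - t)" "y / t"] x y t False by simp
  then show ?thesis
    using * x y t False by simp
qed

section \<open>Estimates for balls, energies and Rayleigh quotients\<close>

lemma sum_dist_ball_pos:
  assumes m: "\<And>x. 0 < m x" and d: "pseudo_metric d"
    and fin: "\<And>z r. 0 \<le> r \<Longrightarrow> finite (dist_ball d z r)" and r: "0 \<le> r"
  shows "0 < (sum m (dist_ball d z r) :: real)"
proof (rule sum_pos)
  have "z \<in> dist_ball d z r"
    using d r by (simp add: dist_ball_def pseudo_metric_def)
  then show "dist_ball d z r \<noteq> {}" by blast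
qed (use m fin r in auto)

text \<open>Each edge charges its two endpoints. By symmetry of \<open>b\<close> and
  \<open>d\<close> both charges have the same total, which cancels the 1/2 in the energy, and the
  edge weights \<open>b x y * d x y powr p\<close> at a vertex \<open>x\<close> add up to at most
  \<open>m x\<close>.\<close>

lemma energy_le_of_pointwise:
  fixes b :: "'a::countable \<Rightarrow> 'a \<Rightarrow> real"
  assumes g: "graph_over b m" and dsym: "\<And>x y. d x y = d y x"
    and adm: "\<And>x. (\<Sum>\<^sub>\<infinity>y. ennreal (b x y * d x y powr p)) \<le> ennreal (m x)"
    and B: "finite B" and G: "\<And>x. 0 \<le> G x" "\<And>x. x \<notin> B \<Longrightarrow> G x = 0" and c: "0 \<le> c"
    and f: "\<And>x y. \<bar>f x - f y\<bar> powr p \<le> c * d x y powr p * (G x + G y)"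
  shows "energy p b f \<le> ennreal (c * (\<Sum>x\<in>B. G x * m x))"
proof -
  have b0: "0 \<le> b x y" and bs: "b x y = b y x" and m0: "0 < m x" for x y
    using g by (auto simp: graph_over_def)
  define w where "w x y = b x y * d x y powr p" for x y
  have w0: "0 \<le> w x y" for x y
    using b0 by (simp add: w_def)
  have ws: "w x y = w y x" for x y
    by (metis bs dsym w_def)
  have wm: "sum (w x) A \<le> m x" if "finite A" for x A
  proof -
    have "ennreal (sum (w x) A) = (\<Sum>\<^sub>\<infinity>y\<in>A. ennreal (w x y))"
      using that w0 by (simp add: sum_ennreal)
    also have "\<dots> \<le> (\<Sum>\<^sub>\<infinity>y. ennreal (w x y))"
      by (rule infsum_mono_neutral) (auto intro: nonneg_summable_on_complete)
    also have "\<dots> \<le> ennreal (m x)"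
      using adm by (simp add: w_def)
    finally show ?thesis
      using m0[of x] by (simp add: ennreal_le_iff less_imp_le)
  qed
  let ?S = "\<Sum>x\<in>B. G x * m x"
  have "(\<Sum>\<^sub>\<infinity>(x, y)\<in>UNIV. ennreal (b x y * \<bar>f x - f y\<bar> powr p)) \<le> ennreal (2 * (c * ?S))"
  proof (subst nonneg_infsum_complete, simp, rule SUP_least, clarify)
    fix F :: "('a \<times> 'a) set"
    assume F: "finite F"
    \<comment> \<open>Enlarging \<open>F\<close> to a square \<open>A \<times> A\<close> makes the
      index set invariant under exchange of the endpoints.\<close>
    define A where "A = fst ` F \<union> snd ` F"
    have A: "finite A" "F \<subseteq> A \<times> A"
      using F by (auto simp: A_def image_iff) force+
    have half: "(\<Sum>x\<in>A. \<Sum>y\<in>A. w x y * G x) \<le> ?S"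
    proof -
      have "(\<Sum>x\<in>A. \<Sum>y\<in>A. w x y * G x) = (\<Sum>x\<in>A. G x * sum (w x) A)"
        by (simp add: sum_distrib_left mult.commute)
      also have "\<dots> \<le> (\<Sum>x\<in>A. G x * m x)"
        using wm A G by (intro sum_mono mult_left_mono) auto
      also have "\<dots> = (\<Sum>x\<in>A \<inter> B. G x * m x)"
        using A G by (intro sum.mono_neutral_right) auto
      also have "\<dots> \<le> ?S"
        using B G less_imp_le[OF m0] by (intro sum_mono2) auto
      finally show ?thesis .
    qed
    have "(\<Sum>(x, y)\<in>F. b x y * \<bar>f x - f y\<bar> powr p)
        \<le> (\<Sum>(x, y)\<in>A \<times> A. b x y * \<bar>f x - f y\<bar> powr p)"
      using A b0 by (intro sum_mono2) auto
    also have "\<dots> = (\<Sum>x\<in>A. \<Sum>y\<in>A. b x y * \<bar>f x - f y\<bar> powr p)"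
      by (simp add: sum.cartesian_product)
    also have "\<dots> \<le> (\<Sum>x\<in>A. \<Sum>y\<in>A. c * (w x y * G x + w x y * G y))"
    proof (intro sum_mono)
      fix x y
      show "b x y * \<bar>f x - f y\<bar> powr p \<le> c * (w x y * G x + w x y * G y)"
        using mult_left_mono[OF f[of x y] b0[of x y]] by (simp add: w_def algebra_simps)
    qed
    also have "\<dots> = c * ((\<Sum>x\<in>A. \<Sum>y\<in>A. w x y * G x) + (\<Sum>x\<in>A. \<Sum>y\<in>A. w x y * G y))"
      by (simp add: sum.distrib flip: sum_distrib_left)
    also have "(\<Sum>x\<in>A. \<Sum>y\<in>A. w x y * G y) = (\<Sum>x\<in>A. \<Sum>y\<in>A. w x y * G x)"
      by (subst sum.swap) (simp add: ws)
    also have "c * ((\<Sum>x\<in>A. \<Sum>y\<in>A. w x y * G x) + (\<Sum>x\<in>A. \<Sum>y\<in>A. w x y * G x)) \<le> c * (?S + ?S)"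
      using half c by (intro mult_left_mono add_mono)
    finally have "(\<Sum>(x, y)\<in>F. b x y * \<bar>f x - f y\<bar> powr p) \<le> 2 * (c * ?S)"
      by simp
    moreover have "(\<Sum>(x, y)\<in>F. ennreal (b x y * \<bar>f x - f y\<bar> powr p))
        = ennreal (\<Sum>(x, y)\<in>F. b x y * \<bar>f x - f y\<bar> powr p)"
      using b0 by (simp add: case_prod_unfold sum_ennreal)
    ultimately show "(\<Sum>(x, y)\<in>F. ennreal (b x y * \<bar>f x - f y\<bar> powr p)) \<le> ennreal (2 * (c * ?S))"
      by (simp add: ennreal_leI)
  qed
  then have "energy p b f \<le> ennreal (2 * (c * ?S)) / 2"
    unfolding energy_def by (rule divide_right_mono_ennreal)
  also have "\<dots> = ennreal (c * ?S)"
    using divide_ennreal[of "2 * (c * ?S)" 2] c G m0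
    by (simp add: sum_nonneg less_imp_le)
  finally show ?thesis .
qed

lemma lambda0_le_finite_support:
  fixes m :: "'a \<Rightarrow> real"
  assumes p: "1 \<le> p" and B: "finite B" and f: "\<And>x. x \<notin> B \<Longrightarrow> f x = 0"
    and N: "0 < (\<Sum>x\<in>B. \<bar>f x\<bar> powr p * m x)"
    and E: "energy p b f \<le> ennreal E" "E \<le> K * (\<Sum>x\<in>B. \<bar>f x\<bar> powr p * m x)"
  shows "lambda0 p b m \<le> ennreal K"
proof -
  let ?N = "\<Sum>x\<in>B. \<bar>f x\<bar> powr p * m x"
  have "(\<Sum>\<^sub>\<infinity>x. \<bar>f x\<bar> powr p * m x) = (\<Sum>\<^sub>\<infinity>x\<in>B. \<bar>f x\<bar> powr p * m x)"
    using f by (intro infsum_cong_neutral) auto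
  then have "lp_norm p m f powr p = ?N"
    using B N p by (simp add: lp_norm_def powr_powr)
  moreover have "f \<in> finitely_supported"
    using finite_subset[OF _ B, of "{x. f x \<noteq> 0}"] f by (auto simp: finitely_supported_def)
  moreover have "f \<noteq> (\<lambda>_. 0)"
    using N by auto
  ultimately have "lambda0 p b m \<le> energy p b f / ennreal ?N"
    unfolding lambda0_def by (metis (no_types, lifting) Diff_iff INF_lower singletonD)
  also have "\<dots> \<le> ennreal (K * ?N) / ennreal ?N"
    using E by (intro divide_right_mono_ennreal) (metis ennreal_leI order_trans)
  also have "\<dots> = ennreal K"
  proof (cases "0 \<le> K")
    case True
    then show ?thesis using N by (simp add: divide_ennreal)
  next
    \<comment> \<open>\<open>ennreal\<close> sends negative reals to 0, so both sides
      vanish.\<close>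
    case False
    then have "K * ?N \<le> 0" using N by (simp add: mult_nonpos_nonneg)
    then show ?thesis using False by (simp add: ennreal_neg)
  qed
  finally show ?thesis .
qed

section \<open>Truncated exponentials as test functions\<close>

text \<open>The first summand in the bound is the main term, the second is the error caused by
  subtracting \<open>c\<close>. The error is made relative to the norm of \<open>f\<close> by
  keeping only the part of that norm on the unit ball, where \<open>f\<close> is at least
  \<open>exp (- a) - c\<close>.\<close>

lemma lambda0_le_exponential_cutoff:
  fixes b :: "'a::countable \<Rightarrow> 'a \<Rightarrow> real"
  assumes g: "graph_over b m" and p: "1 \<le> p" and d: "pseudo_metric d"
    and fin: "\<And>z r. 0 \<le> r \<Longrightarrow> finite (dist_ball d z r)"
    and adm: "\<And>x. (\<Sum>\<^sub>\<infinity>y. ennreal (b x y * d x y powr p)) \<le> ennreal (m x)"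
    and a: "0 < a" and R: "1 < R" and t: "0 < t" "t < 1"
  shows "lambda0 p b m \<le> ennreal (a powr p / 2 * ((1 - t) powr (1 - p) + (t powr (1 - p) + 1) *
    (exp (- (a * R)) powr p * sum m (dist_ball d z R) /
      (sum m (dist_ball d z 1) * (exp (- a) - exp (- (a * R))) powr p))))"
proof -
  define B where "B = dist_ball d z R"
  \<comment> \<open>Truncating the distance at \<open>R\<close> keeps it 1-Lipschitz with respect to
    \<open>d\<close> and makes \<open>h\<close> equal to \<open>c\<close> outside \<open>B\<close>,
    so that \<open>f\<close> vanishes there.\<close>
  define s where "s x = min (d z x) R" for x
  define h where "h x = exp (- (a * s x))" for x
  define c where "c = exp (- (a * R))"
  define f where "f x = h x - c" for x
  \<comment> \<open>The extra \<open>c powr p\<close> pays for edges leaving the ball, whose outer endpoint has \<open>h = c\<close> but \<open>G = 0\<close>.\<close>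
  define G where "G x = (if x \<in> B then h x powr p + c powr p else 0)" for x
  define N where "N = (\<Sum>x\<in>B. \<bar>f x\<bar> powr p * m x)"
  define D where "D = sum m (dist_ball d z 1) * (exp (- a) - c) powr p"
  define V where "V = sum m B"
  define T where "T = (1 - t) powr (1 - p)"
  define U where "U = t powr (1 - p)"
  have m0: "0 < m x" for x
    using g by (auto simp: graph_over_def)
  have d0: "0 \<le> d x y" and dsym: "d x y = d y x"
    and dtri: "d x u \<le> d x y + d y u" for x y u
    using d unfolding pseudo_metric_def by blast+
  have finB: "finite B"
    using fin R by (simp add: B_def)
  have out: "s x = R" if "x \<notin> B" for x
    using that by (auto simp: B_def dist_ball_def s_def)
  have h_ge: "c \<le> h x" for x
    using a by (simp add: c_def h_def s_def)
  have h_out: "h x = c" if "x \<notin> B" for x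
    using out[OF that] by (simp add: h_def c_def)
  have hpos: "0 < h x" and cpos: "0 < c" for x
    by (auto simp: h_def c_def)
  have f0: "0 \<le> f x" for x
    using h_ge by (simp add: f_def)
  have G0: "0 \<le> G x" for x
    by (simp add: G_def)
  have sd: "\<bar>s x - s y\<bar> \<le> d x y" for x y
    using dtri[of z x y] dtri[of z y x] dsym[of x y] by (auto simp: s_def)

  have pointwise: "\<bar>f x - f y\<bar> powr p \<le> a powr p / 2 * d x y powr p * (G x + G y)" for x y
  proof (cases "x \<in> B \<or> y \<in> B")
    case False
    then have "f x = 0" "f y = 0"
      using h_out by (auto simp: f_def)
    then show ?thesis
      using G0 by simp
  next
    case True
    have "\<bar>f x - f y\<bar> \<le> \<bar>a * s x - a * s y\<bar> * ((h x + h y) / 2)"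
      using abs_exp_diff_le_trapezoid[of "a * s x" "a * s y"] by (simp add: f_def h_def)
    also have "\<bar>a * s x - a * s y\<bar> = a * \<bar>s x - s y\<bar>"
      using a by (simp add: abs_mult flip: right_diff_distrib)
    also have "a * \<bar>s x - s y\<bar> * ((h x + h y) / 2) \<le> a * d x y * ((h x + h y) / 2)"
      using a sd hpos[of x] hpos[of y] by (intro mult_right_mono mult_left_mono) auto
    finally have "\<bar>f x - f y\<bar> powr p \<le> (a * d x y * ((h x + h y) / 2)) powr p"
      using p by (intro powr_mono2) auto
    also have "\<dots> = a powr p * d x y powr p * ((h x + h y) / 2) powr p"
      using a d0 hpos[of x] hpos[of y] by (subst powr_mult; simp add: powr_mult)
    also have "\<dots> \<le> a powr p * d x y powr p * ((h x powr p + h y powr p) / 2)"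
      using powr_midpoint_le[OF p hpos hpos] by (intro mult_left_mono) auto
    also have "\<dots> \<le> a powr p * d x y powr p * ((G x + G y) / 2)"
      using True h_out by (intro mult_left_mono) (auto simp: G_def)
    finally show ?thesis
      by simp
  qed
  have en: "energy p b f \<le> ennreal (a powr p / 2 * (\<Sum>x\<in>B. G x * m x))"
    by (rule energy_le_of_pointwise[OF g dsym adm finB G0 _ _ pointwise]) (auto simp: G_def)

  have "0 < sum m (dist_ball d z 1)"
    using sum_dist_ball_pos[OF m0 d fin] by simp
  moreover have "c < exp (- a)"
    using a R by (simp add: c_def)
  ultimately have Dpos: "0 < D"
    by (simp add: D_def)
  have "D = (\<Sum>x\<in>dist_ball d z 1. (exp (- a) - c) powr p * m x)"
    by (simp add: D_def sum_distrib_right mult.commute)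
  also have "\<dots> \<le> (\<Sum>x\<in>dist_ball d z 1. \<bar>f x\<bar> powr p * m x)"
  proof (intro sum_mono mult_right_mono powr_mono2)
    fix x assume "x \<in> dist_ball d z 1"
    then have "exp (- a) \<le> h x"
      using a by (auto simp: dist_ball_def h_def s_def min_def)
    then show "exp (- a) - c \<le> \<bar>f x\<bar>"
      by (simp add: f_def)
  qed (use p m0 \<open>c < exp (- a)\<close> in \<open>auto intro: less_imp_le\<close>)
  also have "\<dots> \<le> N"
    unfolding N_def using R less_imp_le[OF m0]
    by (intro sum_mono2 finB) (auto simp: B_def dist_ball_def)
  finally have DN: "D \<le> N" .

  \<comment> \<open>On \<open>B\<close>, \<open>h = f + c\<close> is split by weighted convexity;
    the 1 in \<open>U + 1\<close> is the extra \<open>c powr p\<close> in \<open>G\<close>.\<close>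
  have "(\<Sum>x\<in>B. G x * m x) \<le> (\<Sum>x\<in>B. (T * \<bar>f x\<bar> powr p + (U + 1) * c powr p) * m x)"
  proof (intro sum_mono mult_right_mono)
    fix x assume "x \<in> B"
    then show "G x \<le> T * \<bar>f x\<bar> powr p + (U + 1) * c powr p"
      using powr_add_le_weighted[OF p f0 cpos t, of x] f0[of x]
      by (simp add: G_def T_def U_def f_def algebra_simps)
  qed (use m0 in \<open>auto intro: less_imp_le\<close>)
  also have "\<dots> = T * N + (U + 1) * (c powr p * V)"
    by (simp add: N_def V_def distrib_right sum.distrib sum_distrib_left mult.assoc)
  \<comment> \<open>Writing the error as a multiple of \<open>D\<close> allows
    \<open>D \<le> N\<close> to turn it into a multiple of \<open>N\<close>.\<close>
  also have "c powr p * V = c powr p * V / D * D"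
    using Dpos by simp
  also have "T * N + (U + 1) * (c powr p * V / D * D) \<le> T * N + (U + 1) * (c powr p * V / D * N)"
    using DN Dpos less_imp_le[OF m0] by (intro add_left_mono mult_left_mono)
      (auto simp: U_def V_def sum_nonneg)
  finally have "a powr p / 2 * (\<Sum>x\<in>B. G x * m x)
      \<le> a powr p / 2 * (T * N + (U + 1) * (c powr p * V / D * N))"
    by (intro mult_left_mono) auto
  then have "a powr p / 2 * (\<Sum>x\<in>B. G x * m x)
      \<le> a powr p / 2 * (T + (U + 1) * (c powr p * V / D)) * N"
    by (simp add: algebra_simps)
  then have "lambda0 p b m \<le> ennreal (a powr p / 2 * (T + (U + 1) * (c powr p * V / D)))"
    using lambda0_le_finite_support[OF p finB _ _ en] DN Dpos h_out
    by (simp add: N_def f_def)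
  then show ?thesis
    by (simp add: T_def U_def c_def V_def D_def B_def)
qed

section \<open>Volume growth makes the cut-off error vanish\<close>

text \<open>For \<open>q < p * a\<close> the bound \<open>m(B_r) \<le> exp (q * r) * m(B_1)\<close>
  makes the cut-off error at most a constant times \<open>exp ((q - p * a) * r)\<close>. First
  \<open>r\<close> is taken large for fixed \<open>t\<close>, then \<open>t\<close> tends to
  0.\<close>

lemma lambda0_le_of_volume_growth_less:
  fixes b :: "'a::countable \<Rightarrow> 'a \<Rightarrow> real"
  assumes g: "graph_over b m" and p: "1 \<le> p" and d: "pseudo_metric d"
    and fin: "\<And>z r. 0 \<le> r \<Longrightarrow> finite (dist_ball d z r)"
    and adm: "\<And>x. (\<Sum>\<^sub>\<infinity>y. ennreal (b x y * d x y powr p)) \<le> ennreal (m x)"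
    and a: "0 < a" and growth: "volume_growth m d < ereal (p * a)"
  shows "lambda0 p b m \<le> ennreal (a powr p / 2)"
proof -
  have m0: "0 < m x" for x
    using g by (auto simp: graph_over_def)
  obtain q where q: "volume_growth m d < ereal q" "q < p * a"
    using ereal_dense2[OF growth] by auto
  \<comment> \<open>A lower limit below \<open>q\<close> yields only arbitrarily large radii, not
    all large ones, and the infimum over centers lets \<open>z\<close> depend on \<open>r\<close>.
    This suffices, since the cut-off bound holds for every center.\<close>
  have freq: "\<exists>\<^sub>F r in at_top. \<exists>z. sum m (dist_ball d z r) \<le> exp (q * r) * sum m (dist_ball d z 1)"
  proof -
    let ?F = "\<lambda>r z. 1 / r * ln (enn2real (vol m (dist_ball d z r)) / enn2real (vol m (dist_ball d z 1)))"
    have "\<exists>\<^sub>F r in at_top. (INF z. ereal (?F r z)) < ereal q"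
    proof (rule ccontr)
      assume "\<not> ?thesis"
      then have "\<forall>\<^sub>F r in at_top. ereal q \<le> (INF z. ereal (?F r z))"
        by (simp add: not_frequently not_less)
      then have "ereal q \<le> volume_growth m d"
        unfolding volume_growth_def by (rule Liminf_bounded)
      with q show False by simp
    qed
    then have "\<exists>\<^sub>F r in at_top. (INF z. ereal (?F r z)) < ereal q \<and> 1 \<le> r"
      by (rule frequently_eventually_frequently[OF _ eventually_ge_at_top])
    then show ?thesis
    proof (rule frequently_elim1, elim conjE)
      fix r :: real
      assume r: "(INF z. ereal (?F r z)) < ereal q" "1 \<le> r"
      then obtain z where z: "?F r z < q"
        by (auto simp: INF_less_iff)
      have pos: "0 < sum m (dist_ball d z s)" if "0 \<le> s" for s
        using fin that by (intro sum_dist_ball_pos[OF m0 d])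
      let ?Q = "sum m (dist_ball d z r) / sum m (dist_ball d z 1)"
      have "1 / r * ln ?Q < q"
        using z r fin m0 by (simp add: enn2real_vol_finite)
      then have "ln ?Q < q * r"
        using r by (simp add: field_simps)
      then have "?Q < exp (q * r)"
        using pos[of r] pos[of 1] r exp_less_mono[of "ln ?Q" "q * r"] by simp
      then have "sum m (dist_ball d z r) \<le> exp (q * r) * sum m (dist_ball d z 1)"
        using pos[of 1] by (simp add: field_simps)
      then show "\<exists>z. sum m (dist_ball d z r) \<le> exp (q * r) * sum m (dist_ball d z 1)" ..
    qed
  qed
  \<comment> \<open>The value at \<open>r = 2\<close> bounds
    \<open>(exp (- a) - exp (- (a * r))) powr p\<close> from below for all \<open>r \<ge> 2\<close>,
    so the denominator no longer depends on \<open>r\<close>.\<close>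
  define D where "D = (exp (- a) - exp (- (a * 2))) powr p"
  have Dpos: "0 < D"
    using a by (simp add: D_def)
  have bound: "lambda0 p b m \<le> ennreal (a powr p / 2 * ((1 - t) powr (1 - p) + t))"
    if t: "0 < t" "t < 1" for t
  proof -
    let ?U = "t powr (1 - p) + 1"
    have "filterlim (\<lambda>r. (q - p * a) * r) at_bot at_top"
      using q by (intro filterlim_tendsto_neg_mult_at_bot[OF tendsto_const _ filterlim_ident]) simp
    then have "((\<lambda>r. exp ((q - p * a) * r)) \<longlongrightarrow> 0) at_top"
      by (rule filterlim_compose[OF exp_at_bot])
    then have "((\<lambda>r. ?U * (exp ((q - p * a) * r) / D)) \<longlongrightarrow> ?U * (0 / D)) at_top"
      using Dpos by (intro tendsto_intros) auto
    then have "\<forall>\<^sub>F r in at_top. ?U * (exp ((q - p * a) * r) / D) < t"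
      using t by (intro order_tendstoD(2)) auto
    then have "\<forall>\<^sub>F r in at_top. ?U * (exp ((q - p * a) * r) / D) < t \<and> 2 \<le> r"
      by (intro eventually_conj eventually_ge_at_top)
    \<comment> \<open>The error is small for all large \<open>r\<close> and the volume bound holds
      for arbitrarily large \<open>r\<close>, so some \<open>r\<close> satisfies both.\<close>
    from frequently_ex[OF frequently_eventually_frequently[OF freq this]]
    obtain r z where r: "?U * (exp ((q - p * a) * r) / D) < t" "2 \<le> r"
      and z: "sum m (dist_ball d z r) \<le> exp (q * r) * sum m (dist_ball d z 1)"
      by auto
    let ?V = "sum m (dist_ball d z 1)"
    let ?D = "(exp (- a) - exp (- (a * r))) powr p"
    have V: "0 < ?V"
      using sum_dist_ball_pos[OF m0 d fin] by simp
    have DD: "D \<le> ?D"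
      unfolding D_def using a r p by (intro powr_mono2) auto
    have "exp (- (a * r)) powr p * sum m (dist_ball d z r) / (?V * ?D)
        \<le> exp (- (a * r)) powr p * (exp (q * r) * ?V) / (?V * D)"
      using z V DD Dpos by (intro frac_le mult_left_mono mult_nonneg_nonneg) auto
    also have "\<dots> = exp ((q - p * a) * r) / D"
      using V by (simp add: exp_powr_real algebra_simps flip: exp_add)
    finally have "?U * (exp (- (a * r)) powr p * sum m (dist_ball d z r) / (?V * ?D))
        \<le> ?U * (exp ((q - p * a) * r) / D)"
      by (intro mult_left_mono) (auto simp: add_nonneg_nonneg)
    also have "\<dots> \<le> t"
      using r by simp
    finally have le: "?U * (exp (- (a * r)) powr p * sum m (dist_ball d z r) / (?V * ?D)) \<le> t" .
    have "lambda0 p b m \<le> ennreal (a powr p / 2 * ((1 - t) powr (1 - p) +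
        ?U * (exp (- (a * r)) powr p * sum m (dist_ball d z r) / (?V * ?D))))"
      using r by (intro lambda0_le_exponential_cutoff[OF g p d fin adm a _ t]) auto
    also have "\<dots> \<le> ennreal (a powr p / 2 * ((1 - t) powr (1 - p) + t))"
      using le by (intro ennreal_leI mult_left_mono add_left_mono) auto
    finally show ?thesis .
  qed
  have "((\<lambda>t. ennreal (a powr p / 2 * ((1 - t) powr (1 - p) + t)))
      \<longlongrightarrow> ennreal (a powr p / 2 * ((1 - 0) powr (1 - p) + 0))) (at_right 0)"
    by (intro tendsto_intros tendsto_ennrealI) auto
  moreover have "\<forall>\<^sub>F t in at_right 0. lambda0 p b m \<le> ennreal (a powr p / 2 * ((1 - t) powr (1 - p) + t))"
    using bound by (intro eventually_at_rightI[of 0 1]) auto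
  ultimately have "lambda0 p b m \<le> ennreal (a powr p / 2 * ((1 - 0) powr (1 - p) + 0))"
    by (rule tendsto_lowerbound) simp
  then show ?thesis by simp
qed

theorem theorem4p1:
  fixes b :: "'a::countable \<Rightarrow> 'a \<Rightarrow> real"
    and m :: "'a \<Rightarrow> real"
    and d :: "'a \<Rightarrow> 'a \<Rightarrow> real"
    and p :: real
  assumes "graph_over b m"
    and "1 \<le> p"
    and "pseudo_metric d"
    and "\<And>z r. 0 \<le> r \<Longrightarrow> finite (dist_ball d z r)"
    and "\<And>x. (\<Sum>\<^sub>\<infinity>y. ennreal (b x y * d x y powr p)) \<le> ennreal (m x)"
  shows "lambda0 p b m \<le>
    (if volume_growth m d = \<infinity> then \<infinity>
     else ennreal (real_of_ereal (volume_growth m d) powr p / (2 * p powr p)))"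
proof (cases "volume_growth m d = \<infinity>")
  case False
  \<comment> \<open>\<open>volume_growth_nonneg\<close> asks for finiteness at every real radius;
    balls of negative radius are empty.\<close>
  have "finite (dist_ball d z r)" for z r
  proof (cases "0 \<le> r")
    case False
    then have "dist_ball d z r = {}"
      using assms(3) by (auto simp: dist_ball_def pseudo_metric_def) (meson order_trans)
    then show ?thesis by simp
  qed (use assms(4) in auto)
  then have "0 \<le> volume_growth m d"
    using assms(1,3) by (intro volume_growth_nonneg) (auto simp: graph_over_def)
  then obtain \<mu> where \<mu>: "volume_growth m d = ereal \<mu>" "0 \<le> \<mu>"
    using False by (cases "volume_growth m d") auto
  have p: "0 < p"
    using assms(2) by simp
  have "((\<lambda>a. ennreal (a powr p / 2)) \<longlongrightarrow> ennreal ((\<mu> / p) powr p / 2)) (at_right (\<mu> / p))"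
  proof (intro tendsto_ennrealI tendsto_divide tendsto_powr' tendsto_const tendsto_ident_at)
    \<comment> \<open>If \<open>\<mu> = 0\<close>, the base of the power tends to 0; continuity
      there uses \<open>0 < p\<close> and the approach from the right.\<close>
    show "\<mu> / p \<noteq> 0 \<or> 0 < p \<and> (\<forall>\<^sub>F a in at_right (\<mu> / p). 0 \<le> a)"
      using p \<mu> by (cases "\<mu> = 0") (auto intro: eventually_at_rightI[of 0 1])
  qed simp
  moreover have "\<forall>\<^sub>F a in at_right (\<mu> / p). lambda0 p b m \<le> ennreal (a powr p / 2)"
  proof (rule eventually_at_rightI)
    fix a assume "a \<in> {\<mu> / p<..<\<mu> / p + 1}"
    then have "\<mu> / p < a" by simp
    moreover from this have "0 < a"
      using p \<mu> by (meson divide_nonneg_pos le_less_trans)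
    ultimately show "lambda0 p b m \<le> ennreal (a powr p / 2)"
      using p \<mu> by (intro lambda0_le_of_volume_growth_less[OF assms]) (auto simp: field_simps)
  qed simp
  ultimately have "lambda0 p b m \<le> ennreal ((\<mu> / p) powr p / 2)"
    by (rule tendsto_lowerbound) simp
  then show ?thesis
    using \<mu> p by (simp add: powr_divide mult.commute)
qed simp

end
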